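(* Let $q$ be a prime power, $t,n,k$ positive integers, and $1\le \lambda'\le\lambda$. If $C$ is a $\mathrm{CPHF}_{\lambda}(n;t,k,q)$, then there exists a $\mathrm{CA}_{\lambda'}(n(q^t-1)+\lambda';\,t,k,q)$. If moreover $C$ is an $\mathrm{SCPHF}_{\lambda}(n;t,k,q)$, then there exists a $\mathrm{CA}_{\lambda'}(n(q^t-q)+\lambda' q;\,t,k,q)$.
   Context: A covering perfect hash family $\mathrm{CPHF}_{\lambda}(n;t,k,q)$ is an $n\times k$ array with entries from $\mathbb{F}_q^t\setminus\{\vec 0\}$ such that for each set $T$ of $t$ columns there exist at least $\lambda$ rows whose entries in the columns of $T$ are linearly independent over $\mathbb{F}_q$. If all vector entries have nonzero last coordinate, it is a Sherwood covering perfect hash family $\mathrm{SCPHF}_{\lambda}(n;t,k,q)$. A covering array $\mathrm{CA}_{\lambda}(N;t,k,v)$ is an $N\times k$ array with entries from a $v$-set such that for every set $T$ of $t$ columns and every $t$-tuple over the $v$-set, at least $\lambda$ rows have entries in the columns of $T$ equal to that $t$-tuple. *)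

theory Defs
  imports
    "Jordan_Normal_Form.VS_Connect"
    "HOL-Number_Theory.Prime_Powers"
begin

text \<open>An $n \times k$ array is an element of \<open>carrier_mat n k\<close>; rows and columns are indexed
  from 0. The field $\mathbb{F}_q$ is a finite field type \<open>'a\<close> with \<open>card (UNIV :: 'a set) = q\<close>,
  so \<open>q\<close> is not an argument of the predicates for perfect hash families.\<close>

text \<open>\<open>module.lin_dep\<close> is a predicate on sets of vectors. A family of vectors with a repeated
  member is linearly dependent, hence the injectivity condition.\<close>

definition lin_indpt_family :: "nat \<Rightarrow> ('i \<Rightarrow> 'a::field vec) \<Rightarrow> 'i set \<Rightarrow> bool" where
  "lin_indpt_family t f T \<longleftrightarrow>
     inj_on f T \<and> \<not> module.lin_dep class_ring (module_vec TYPE('a) t) (f ` T)"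

definition cphf :: "nat \<Rightarrow> nat \<Rightarrow> nat \<Rightarrow> nat \<Rightarrow> 'a::{field,finite} vec mat \<Rightarrow> bool" where
  "cphf lam n t k C \<longleftrightarrow>
     C \<in> carrier_mat n k \<and>
     (\<forall>i<n. \<forall>j<k. C $$ (i, j) \<in> carrier_vec t - {0\<^sub>v t}) \<and>
     (\<forall>T. T \<subseteq> {..<k} \<and> card T = t \<longrightarrow>
        lam \<le> card {i. i < n \<and> lin_indpt_family t (\<lambda>j. C $$ (i, j)) T})"

definition scphf :: "nat \<Rightarrow> nat \<Rightarrow> nat \<Rightarrow> nat \<Rightarrow> 'a::{field,finite} vec mat \<Rightarrow> bool" where
  "scphf lam n t k C \<longleftrightarrow>
     cphf lam n t k C \<and> (\<forall>i<n. \<forall>j<k. C $$ (i, j) $ (t - 1) \<noteq> 0)"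

text \<open>\<open>V\<close> is the \<open>v\<close>-set of symbols. A \<open>t\<close>-tuple for the columns in \<open>T\<close> is given by the values
  on \<open>T\<close> of a function \<open>x\<close>.\<close>

definition covering_array ::
    "nat \<Rightarrow> nat \<Rightarrow> nat \<Rightarrow> nat \<Rightarrow> nat \<Rightarrow> 'b set \<Rightarrow> 'b mat \<Rightarrow> bool" where
  "covering_array lam N t k v V A \<longleftrightarrow>
     finite V \<and> card V = v \<and>
     A \<in> carrier_mat N k \<and>
     (\<forall>i<N. \<forall>j<k. A $$ (i, j) \<in> V) \<and>
     (\<forall>T x. T \<subseteq> {..<k} \<and> card T = t \<and> x \<in> T \<rightarrow> V \<longrightarrow>
        lam \<le> card {i. i < N \<and> (\<forall>j\<in>T. A $$ (i, j) = x j)})"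

end

theory Submission
  imports Defs "Berlekamp_Zassenhaus.Berlekamp_Type_Based"
begin

text \<open>The linear functional \<open>h\<close> on \<open>\<F>\<^sub>q\<^sup>t\<close>, applied to row \<open>i\<close> of \<open>C\<close>, gives a row of the covering
  array. If the entries of row \<open>i\<close> in the columns \<open>T\<close> form a basis, then each tuple on \<open>T\<close> is
  attained by some functional. Functionals whose rows do not depend on \<open>i\<close> (the zero functional and,
  after each entry is divided by its last coordinate, the multiples of the last coordinate functional)
  give constant rows, and it is enough to keep \<open>\<lambda>'\<close> copies of these.\<close>

text \<open>By dimension \<open>S\<close> is a basis, so orthogonality to \<open>S\<close> extends
  to the whole space. Pairing \<open>v\<close> with the unit vectors then reads off its coordinates,
  which must all vanish.\<close>

lemma (in vec_space) lin_indpt_orthogonal_eq_zero: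
  assumes "S \<subseteq> carrier_vec n" "lin_indpt S" "card S = n" "finite S"
    and "v \<in> carrier_vec n" "\<And>s. s \<in> S \<Longrightarrow> v \<bullet> s = 0"
  shows "v = 0\<^sub>v n"
proof -
  have "basis S"
    using assms(1-4) by (intro dim_li_is_basis) (auto simp: dim_is_n)
  then have "span S = carrier_vec n"
    by (simp add: basis_def)
  moreover have "v \<in> orthogonal_complement (span S)"
    unfolding in_orthogonal_complement_span[OF assms(1)]
    using assms(5,6) by (simp add: orthogonal_complement_def)
  ultimately have "v \<bullet> unit_vec n i = 0" for i
    by (simp add: orthogonal_complement_def)
  then show ?thesis
    using assms(5) by (intro eq_vecI) (metis index_zero_vec(1,2) scalar_prod_right_unit, simp)
qed

text \<open>Surjectivity is obtained by counting: evaluation of functionals on the family is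
  injective by the previous lemma, and over a finite field its domain and codomain have the same
  finite size.\<close>

lemma lin_indpt_family_scalar_prod_surj:
  fixes f :: "'i \<Rightarrow> 'a::{field,finite} vec"
  assumes li: "lin_indpt_family t f T" and T: "card T = t" "finite T"
    and f: "\<And>j. j \<in> T \<Longrightarrow> f j \<in> carrier_vec t"
  shows "\<exists>h\<in>carrier_vec t. \<forall>j\<in>T. h \<bullet> f j = x j"
proof -
  interpret vec_space "TYPE('a)" t .
  \<comment> \<open>Restricting to \<open>T\<close> puts the values into the extensional function
    space \<open>?P\<close>, which is finite and has as many elements as there are vectors of length
    \<open>t\<close>.\<close>
  let ?E = "\<lambda>h. \<lambda>j\<in>T. h \<bullet> f j"
  let ?P = "T \<rightarrow>\<^sub>E (UNIV :: 'a set)"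
  have f_inj: "inj_on f T" and indpt: "lin_indpt (f ` T)"
    using li by (auto simp: lin_indpt_family_def)
  have "inj_on ?E (carrier_vec t)"
  proof (rule inj_onI)
    fix v w :: "'a vec"
    assume v: "v \<in> carrier_vec t" and w: "w \<in> carrier_vec t" and eq: "?E v = ?E w"
    have "(v - w) \<bullet> f j = 0" if "j \<in> T" for j
      using v w f[OF that] fun_cong[OF eq, of j] that
      by (simp add: minus_scalar_prod_distrib[of _ t])
    then have "v - w = 0\<^sub>v t"
      using v w T f indpt card_image[OF f_inj]
      by (intro lin_indpt_orthogonal_eq_zero[of "f ` T"]) auto
    then show "v = w"
      using v w by (metis carrier_vecD eq_iff_diff_eq_0 eq_vecI index_minus_vec(1) index_zero_vec(1))
  qed
  moreover have "?E ` carrier_vec t \<subseteq> ?P"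
    by auto
  moreover have "card (carrier_vec t :: 'a vec set) = card ?P"
    using T by (simp add: card_carrier_vec card_PiE)
  moreover have "finite ?P"
    using T by (simp add: finite_PiE)
  ultimately have "?E ` carrier_vec t = ?P"
    by (metis card_image card_subset_eq)
  then have "restrict x T \<in> ?E ` carrier_vec t"
    by simp
  then obtain h where "h \<in> carrier_vec t" "?E h = restrict x T"
    by auto
  then show ?thesis
    by (metis restrict_apply')
qed

text \<open>The order of rows is irrelevant to covering, so rows may be labelled by any finite set.
  Equal rows with different labels are counted separately, which is how multiplicities
  enter.\<close>

lemma covering_array_of_rows:
  fixes F :: "'r \<Rightarrow> nat \<Rightarrow> 'b"
  assumes R: "finite R" "card R = N" and V: "finite V" "card V = v"
    and F: "\<And>r j. r \<in> R \<Longrightarrow> j < k \<Longrightarrow> F r j \<in> V"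
    and cover: "\<And>T x. T \<subseteq> {..<k} \<Longrightarrow> card T = t \<Longrightarrow> x \<in> T \<rightarrow> V \<Longrightarrow>
      lam \<le> card {r \<in> R. \<forall>j\<in>T. F r j = x j}"
  shows "\<exists>A. covering_array lam N t k v V A"
proof -
  obtain b where b: "bij_betw b {0..<N} R"
    using ex_bij_betw_nat_finite[OF R(1)] R(2) by auto
  define A where "A = mat N k (\<lambda>(i, j). F (b i) j)"
  have "covering_array lam N t k v V A"
    unfolding covering_array_def
  proof (intro conjI allI impI; (elim conjE)?)
    fix T x
    assume T: "T \<subseteq> {..<k}" "card T = t" "x \<in> T \<rightarrow> V"
    have b_less: "b i \<in> R" if "i < N" for i
      using that bij_betwE[OF b] by simp
    have "{r \<in> R. \<forall>j\<in>T. F r j = x j} \<subseteq> b ` {i. i < N \<and> (\<forall>j\<in>T. A $$ (i, j) = x j)}"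
    proof safe
      fix r assume r: "r \<in> R" "\<forall>j\<in>T. F r j = x j"
      obtain i where "i < N" "r = b i"
        using r(1) bij_betw_imp_surj_on[OF b] by auto
      then show "r \<in> b ` {i. i < N \<and> (\<forall>j\<in>T. A $$ (i, j) = x j)}"
        using r(2) T(1) by (auto simp: A_def subset_iff)
    qed
    then have "card {r \<in> R. \<forall>j\<in>T. F r j = x j} \<le>
        card {i. i < N \<and> (\<forall>j\<in>T. A $$ (i, j) = x j)}"
      by (intro surj_card_le) auto
    then show "lam \<le> card {i. i < N \<and> (\<forall>j\<in>T. A $$ (i, j) = x j)}"
      using cover[OF T] by simp
  next
    fix i j assume "i < N" "j < k"
    then show "A $$ (i, j) \<in> V"
      using F bij_betwE[OF b] by (simp add: A_def)
  qed (use V in \<open>auto simp: A_def\<close>)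
  then show ?thesis ..
qed

text \<open>A tuple equal to some constant \<open>g h\<close> with \<open>h\<close> in
  \<open>S\<close> is covered by the copies of that row. For any other tuple, a functional producing
  it from row \<open>i\<close> cannot lie in \<open>S\<close>, so each good \<open>i\<close>
  contributes a row of the first kind.\<close>

lemma covering_array_of_functionals:
  fixes D :: "nat \<Rightarrow> nat \<Rightarrow> 'h \<Rightarrow> 'b::finite"
  assumes H: "finite H" "S \<subseteq> H"
    and const: "\<And>i j h. i < n \<Longrightarrow> j < k \<Longrightarrow> h \<in> S \<Longrightarrow> D i j h = g h"
    and surj: "\<And>T. T \<subseteq> {..<k} \<Longrightarrow> card T = t \<Longrightarrow>
      lam' \<le> card {i. i < n \<and> (\<forall>x. \<exists>h\<in>H. \<forall>j\<in>T. D i j h = x j)}"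
  shows "\<exists>A. covering_array lam' (n * (card H - card S) + lam' * card S) t k
    (card (UNIV :: 'b set)) (UNIV :: 'b set) A"
proof (rule covering_array_of_rows)
  \<comment> \<open>The left summand has one row for each \<open>i\<close> and each functional
    outside \<open>S\<close>; in the right one the first component merely numbers the
    copies.\<close>
  let ?R = "({..<n} \<times> (H - S)) <+> ({..<lam'} \<times> S)"
  let ?F = "\<lambda>r j. case r of Inl (i, h) \<Rightarrow> D i j h | Inr (_, h) \<Rightarrow> g h"
  have S: "finite S"
    using H finite_subset by blast
  show R: "finite ?R"
    using H S by simp
  show "card ?R = n * (card H - card S) + lam' * card S"
    using H S by (simp add: card_Plus card_cartesian_product card_Diff_subset)
  fix T and x :: "nat \<Rightarrow> 'b"
  assume T: "T \<subseteq> {..<k}" "card T = t"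
  define I where "I = {i. i < n \<and> (\<forall>x. \<exists>h\<in>H. \<forall>j\<in>T. D i j h = x j)}"
  let ?Q = "{r \<in> ?R. \<forall>j\<in>T. ?F r j = x j}"
  have finQ: "finite ?Q"
    using R by simp
  have le: "lam' \<le> card I"
    using surj[OF T] by (simp add: I_def)
  show "lam' \<le> card ?Q"
  proof (cases "\<exists>h\<in>S. \<forall>j\<in>T. g h = x j")
    case True
    then obtain h where h: "h \<in> S" "\<forall>j\<in>T. g h = x j"
      by blast
    have "card ((\<lambda>a. Inr (a, h) :: nat \<times> 'h + nat \<times> 'h) ` {..<lam'}) \<le> card ?Q"
      using h by (intro card_mono[OF finQ]) auto
    then show ?thesis
      by (simp add: card_image inj_on_def)
  next
    case False
    have "\<forall>i\<in>I. \<exists>h\<in>H. \<forall>j\<in>T. D i j h = x j"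
      by (auto simp: I_def)
    then obtain h where h: "h i \<in> H" "\<forall>j\<in>T. D i j (h i) = x j" if "i \<in> I" for i
      by metis
    have "h i \<notin> S" if "i \<in> I" for i
    proof
      assume hS: "h i \<in> S"
      have "g (h i) = x j" if "j \<in> T" for j
        using const[of i j "h i"] h(2)[OF \<open>i \<in> I\<close>] \<open>i \<in> I\<close> that hS T(1) by (auto simp: I_def)
      then show False
        using False hS by blast
    qed
    \<comment> \<open>The labels are distinct because they carry \<open>i\<close>, even if the
      chosen functionals \<open>h i\<close> coincide.\<close>
    then have "card ((\<lambda>i. Inl (i, h i) :: nat \<times> 'h + nat \<times> 'h) ` I) \<le> card ?Q"
      using h by (intro card_mono[OF finQ]) (auto simp: I_def)
    then show ?thesis
      using le by (simp add: card_image inj_on_def)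
  qed
qed auto

theorem theorem4p3:
  fixes q t n k lam lam' :: nat
    and C :: "'a::{field,finite} vec mat"
  assumes "primepow q" and "card (UNIV :: 'a set) = q"
    and "t > 0" and "n > 0" and "k > 0"
    and "1 \<le> lam'" and "lam' \<le> lam"
    and "cphf lam n t k C"
  shows "(\<exists>(V :: 'a set) A. covering_array lam' (n * (q ^ t - 1) + lam') t k q V A) \<and>
    (scphf lam n t k C \<longrightarrow>
      (\<exists>(V :: 'a set) A. covering_array lam' (n * (q ^ t - q) + lam' * q) t k q V A))"
proof (intro conjI impI)
  let ?H = "carrier_vec t :: 'a vec set"
  have q: "q = card (UNIV :: 'a set)"
    using assms(2) by simp
  have cardH: "card ?H = q ^ t"
    by (simp add: card_carrier_vec q)
  have C: "C $$ (i, j) \<in> carrier_vec t" if "i < n" "j < k" for i j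
    using assms(8) that by (auto simp: cphf_def)
  have surj: "\<exists>h\<in>?H. \<forall>j\<in>T. h \<bullet> C $$ (i, j) = x j"
    if "lin_indpt_family t (\<lambda>j. C $$ (i, j)) T" "i < n" "T \<subseteq> {..<k}" "card T = t" for T i x
    using that C finite_subset[OF that(3)] by (intro lin_indpt_family_scalar_prod_surj) auto
  have rows: "lam' \<le> card {i. i < n \<and> P i}"
    if "T \<subseteq> {..<k}" "card T = t"
      "\<And>i. i < n \<Longrightarrow> lin_indpt_family t (\<lambda>j. C $$ (i, j)) T \<Longrightarrow> P i" for T P
  proof -
    have "lam \<le> card {i. i < n \<and> lin_indpt_family t (\<lambda>j. C $$ (i, j)) T}"
      using assms(8) that(1,2) by (simp add: cphf_def)
    also have "\<dots> \<le> card {i. i < n \<and> P i}"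
      using that(3) by (intro card_mono) auto
    finally show ?thesis
      using assms(7) by simp
  qed
  \<comment> \<open>General case: \<open>S\<close> consists of the zero functional alone, whose row
    is zero for every \<open>i\<close>.\<close>
  have "\<exists>A. covering_array lam' (n * (card ?H - card {0\<^sub>v t :: 'a vec}) + lam' * card {0\<^sub>v t :: 'a vec})
      t k (card (UNIV :: 'a set)) (UNIV :: 'a set) A"
  proof (rule covering_array_of_functionals[where D = "\<lambda>i j h. h \<bullet> C $$ (i, j)" and g = "\<lambda>_. 0"])
    fix T assume T: "T \<subseteq> {..<k}" "card T = t"
    show "lam' \<le> card {i. i < n \<and> (\<forall>x. \<exists>h\<in>?H. \<forall>j\<in>T. h \<bullet> C $$ (i, j) = x j)}"
      by (intro rows[OF T] allI surj T)
  qed (use C in \<open>auto simp: card_carrier_vec intro: card_ge_0_finite\<close>)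
  then show "\<exists>(V :: 'a set) A. covering_array lam' (n * (q ^ t - 1) + lam') t k q V A"
    unfolding cardH by (auto simp: q)
  assume "scphf lam n t k C"
  then have nz: "C $$ (i, j) $ (t - 1) \<noteq> 0" if "i < n" "j < k" for i j
    using that by (simp add: scphf_def)
  \<comment> \<open>Sherwood case: \<open>S\<close> is the range of \<open>e\<close>, the
    \<open>q\<close> multiples of the last coordinate functional. On a vector scaled to last
    coordinate 1, \<open>e c\<close> takes the value \<open>c\<close>.\<close>
  define e where "e c = c \<cdot>\<^sub>v unit_vec t (t - 1)" for c :: 'a
  have e: "e c \<bullet> v = c * v $ (t - 1)" "e c $ (t - 1) = c" if "v \<in> carrier_vec t" for c v
    using that assms(3) by (auto simp: e_def)
  have "inj e"
    using e(2)[OF zero_carrier_vec] by (metis injI)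
  then have cardS: "card (range e) = q"
    by (simp add: card_image q)
  have "\<exists>A. covering_array lam' (n * (card ?H - card (range e)) + lam' * card (range e))
      t k (card (UNIV :: 'a set)) (UNIV :: 'a set) A"
  proof (rule covering_array_of_functionals[where
        D = "\<lambda>i j h. (h \<bullet> C $$ (i, j)) / C $$ (i, j) $ (t - 1)" and g = "\<lambda>h. h $ (t - 1)"])
    fix i j h assume "i < n" "j < k" "h \<in> range e"
    then show "(h \<bullet> C $$ (i, j)) / C $$ (i, j) $ (t - 1) = h $ (t - 1)"
      using e[OF C] nz by auto
  next
    fix T assume T: "T \<subseteq> {..<k}" "card T = t"
    show "lam' \<le> card {i. i < n \<and>
      (\<forall>x. \<exists>h\<in>?H. \<forall>j\<in>T. (h \<bullet> C $$ (i, j)) / C $$ (i, j) $ (t - 1) = x j)}"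
    proof (rule rows[OF T], rule allI)
      fix i x assume i: "i < n" "lin_indpt_family t (\<lambda>j. C $$ (i, j)) T"
      \<comment> \<open>The target is multiplied by the last coordinates in advance, so that the
        division in \<open>D\<close> returns \<open>x\<close>; the entries of \<open>C\<close>
        themselves stay unscaled.\<close>
      obtain h where h: "h \<in> ?H" "\<forall>j\<in>T. h \<bullet> C $$ (i, j) = x j * C $$ (i, j) $ (t - 1)"
        using surj[OF i(2,1) T, of "\<lambda>j. x j * C $$ (i, j) $ (t - 1)"] by blast
      have "\<forall>j\<in>T. (h \<bullet> C $$ (i, j)) / C $$ (i, j) $ (t - 1) = x j"
        using h(2) nz[OF i(1)] T(1) by auto
      then show "\<exists>h\<in>?H. \<forall>j\<in>T. (h \<bullet> C $$ (i, j)) / C $$ (i, j) $ (t - 1) = x j"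
        using h(1) by blast
    qed
  qed (auto simp: e_def)
  then show "\<exists>(V :: 'a set) A. covering_array lam' (n * (q ^ t - q) + lam' * q) t k q V A"
    unfolding cardH cardS by (auto simp: q)
qed

end
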